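(* Let $m\geq 3$ be an integer and let $D$ be a strongly connected digraph with minimum semi-degree $\delta(D)=\min\{\delta^+(D),\delta^-(D)\}\geq m+1$. Then $D$ contains a subdigraph $T$ isomorphic to the out-star $OS_m$ or to the in-star $IS_m$ such that $D-V(T)$ is strongly connected.
   Context: Digraphs are finite, without loops and without parallel arcs. A digraph is strongly connected if for every ordered pair of vertices $x,y$ there is a directed path from $x$ to $y$. $\delta^+(D)$ and $\delta^-(D)$ are the minimum out-degree and minimum in-degree of $D$. $D-V(T)$ is the subdigraph induced by $V(D)\setminus V(T)$. A star is a tree with exactly one vertex (the center) of degree greater than one (so a star of order $m$ requires $m\ge 3$). The out-star $OS_m$ is the digraph obtained from a star of order $m$ by orienting every edge away from the center, i.e. vertices $c,v_1,\dots,v_{m-1}$ and arcs $(c,v_i)$, $i=1,\dots,m-1$. The in-star $IS_m$ is obtained by orienting every edge towards the center, i.e. arcs $(v_i,c)$. *)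

theory Defs
  imports "Graph_Theory.Graph_Theory"
begin

definition min_out_degree :: "('a, 'b) pre_digraph \<Rightarrow> nat" where
  "min_out_degree D = Min (out_degree D ` verts D)"

definition min_in_degree :: "('a, 'b) pre_digraph \<Rightarrow> nat" where
  "min_in_degree D = Min (in_degree D ` verts D)"

definition min_semi_degree :: "('a, 'b) pre_digraph \<Rightarrow> nat" where
  "min_semi_degree D = min (min_out_degree D) (min_in_degree D)"

text \<open>The stars of order \<open>m\<close> on the vertex set \<open>{0,\<dots>,m-1}\<close>, with center \<open>0\<close> and leaves
  \<open>1,\<dots>,m-1\<close>.\<close>

definition out_star :: "nat \<Rightarrow> nat pair_pre_digraph" where
  "out_star m = \<lparr> pverts = {0..<m}, parcs = {(0, i) | i. i \<in> {1..<m}} \<rparr>"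

definition in_star :: "nat \<Rightarrow> nat pair_pre_digraph" where
  "in_star m = \<lparr> pverts = {0..<m}, parcs = {(i, 0) | i. i \<in> {1..<m}} \<rparr>"

end

theory Submission
  imports Defs
begin

text \<open>
  Among the vertex sets \<open>C\<close> that induce a strong subdigraph and leave a star of order \<open>m\<close> outside,
  take a largest one; the claim is that nothing but the star is left. An ear of \<open>C\<close> is a walk outside
  \<open>C\<close> that starts at an out-neighbour and ends at an in-neighbour of \<open>C\<close>; adding an ear keeps \<open>C\<close>
  strong, so by maximality no ear leaves a star outside. Let \<open>p\<^sub>1, \<dots>, p\<^sub>k\<close> be a shortest ear. If
  \<open>k \<le> 2\<close>, a vertex off the ear that is not adjacent both to and from \<open>C\<close> has at least \<open>m - 1\<close> out-
  or in-neighbours outside \<open>C\<close> and the ear. If \<open>k \<ge> 3\<close>, an out-neighbour of \<open>C\<close> off the ear sees at most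
  \<open>p\<^sub>1\<close> and \<open>p\<^sub>2\<close> on it and hence is the center of such a star, so \<open>p\<^sub>1\<close> is the only out-neighbour of
  \<open>C\<close>. Every out-neighbour \<open>v \<noteq> p\<^sub>2\<close> of \<open>p\<^sub>1\<close> sees at most \<open>p\<^sub>1\<close>, \<open>p\<^sub>2\<close>, \<open>p\<^sub>3\<close> on the ear, and must see
  all three. Then any of these \<open>v\<close> may replace \<open>p\<^sub>2\<close>, so the at least \<open>m + 1\<close> out-neighbours of
  \<open>p\<^sub>1\<close> see each other, and again there is a star off the ear.
\<close>

section \<open>Strong vertex sets, stars and ears of a relation\<close>

definition strong_on :: "'a rel \<Rightarrow> 'a set \<Rightarrow> bool" where
  "strong_on E S \<longleftrightarrow> S \<noteq> {} \<and> (\<forall>u\<in>S. \<forall>v\<in>S. (u, v) \<in> rtrancl_on S E)"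

text \<open>\<open>n\<close> counts leaves, so order \<open>m\<close> means
  \<open>has_star E (m - 1)\<close>. Surplus neighbours are allowed, which makes the notion monotone
  in \<open>S\<close>.\<close>

definition has_star :: "'a rel \<Rightarrow> nat \<Rightarrow> 'a set \<Rightarrow> bool" where
  "has_star E n S \<longleftrightarrow> (\<exists>c\<in>S. n \<le> card (E `` {c} \<inter> S) \<or> n \<le> card (E\<inverse> `` {c} \<inter> S))"

text \<open>A walk rather than a path: vertices may repeat, so a spliced walk is an ear without
  further checks. A single vertex with arcs from and to \<open>C\<close> is an ear.\<close>

definition ear :: "'a rel \<Rightarrow> 'a set \<Rightarrow> 'a list \<Rightarrow> bool" where
  "ear E C ps \<longleftrightarrow> ps \<noteq> [] \<and> set ps \<inter> C = {} \<and> successively (\<lambda>x y. (x, y) \<in> E) ps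
    \<and> hd ps \<in> E `` C \<and> last ps \<in> E\<inverse> `` C"

lemma has_star_mono:
  assumes "has_star E n S" "S \<subseteq> S'" "finite S'"
  shows "has_star E n S'"
proof -
  have "card (R \<inter> S) \<le> card (R \<inter> S')" for R
    using assms by (intro card_mono) auto
  then show ?thesis
    using assms unfolding has_star_def by (meson le_trans subsetD)
qed

lemma walk_reaches_member:
  assumes "successively (\<lambda>x y. (x, y) \<in> E) ps" "set ps \<subseteq> S" "x \<in> set ps"
  shows "(hd ps, x) \<in> rtrancl_on S E"
  using assms
proof (induction ps)
  case (Cons p ps)
  then show ?case
    by (cases ps) (auto intro: converse_rtrancl_on_into_rtrancl_on)
qed simp

lemma walk_member_reaches_last:
  assumes "successively (\<lambda>x y. (x, y) \<in> E) ps" "set ps \<subseteq> S" "x \<in> set ps"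
  shows "(x, last ps) \<in> rtrancl_on S E"
  using assms
proof (induction ps arbitrary: x)
  case (Cons p ps)
  show ?case
  proof (cases "ps = []")
    case False
    then have IH: "(y, last ps) \<in> rtrancl_on S E" if "y \<in> set ps" for y
      using Cons that by (simp add: successively_Cons)
    have "(p, last ps) \<in> rtrancl_on S E"
      using IH[of "hd ps"] Cons.prems False
      by (auto simp: successively_Cons intro: converse_rtrancl_on_into_rtrancl_on)
    then show ?thesis
      using IH Cons.prems False by auto
  qed (use Cons.prems in simp)
qed simp

text \<open>Let the ear leave \<open>C\<close> at \<open>a\<close> and return at \<open>b\<close>.
  Every vertex of the union is reached from \<open>a\<close> and reaches \<open>b\<close>, and
  inside \<open>C\<close> there is a path from \<open>b\<close> back to \<open>a\<close>.\<close>

lemma strong_on_union_ear: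
  assumes C: "strong_on E C" and ps: "ear E C ps"
  shows "strong_on E (C \<union> set ps)"
proof -
  let ?S = "C \<union> set ps"
  have inC: "(u, v) \<in> rtrancl_on ?S E" if "u \<in> C" "v \<in> C" for u v
    using C that rtrancl_on_mono[of E E C ?S u v] by (auto simp: strong_on_def)
  obtain a b where ab: "a \<in> C" "(a, hd ps) \<in> E" "b \<in> C" "(last ps, b) \<in> E"
    using ps by (auto simp: ear_def)
  have walk: "successively (\<lambda>x y. (x, y) \<in> E) ps"
    using ps by (simp add: ear_def)
  have "(a, x) \<in> rtrancl_on ?S E \<and> (x, b) \<in> rtrancl_on ?S E" if "x \<in> ?S" for x
  proof (cases "x \<in> C")
    case True
    then show ?thesis using inC ab by blast
  next
    case False
    with that have "x \<in> set ps" by simp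
    then show ?thesis
      using walk_reaches_member[OF walk, of ?S x] walk_member_reaches_last[OF walk, of ?S x] ab
      by (auto intro: converse_rtrancl_on_into_rtrancl_on rtrancl_on_into_rtrancl_on)
  qed
  then have "(x, y) \<in> rtrancl_on ?S E" if "x \<in> ?S" "y \<in> ?S" for x y
    using that inC[OF ab(3,1)] by (meson rtrancl_on_trans)
  then show ?thesis
    using C by (auto simp: strong_on_def)
qed

text \<open>Cut a path that ends in \<open>C\<close> just before its first vertex in
  \<open>C\<close>.\<close>

lemma walk_into:
  assumes "(x, c) \<in> rtrancl_on V E" "x \<notin> C" "c \<in> C"
  shows "\<exists>ps. ps \<noteq> [] \<and> hd ps = x \<and> set ps \<inter> C = {}
    \<and> successively (\<lambda>x y. (x, y) \<in> E) ps \<and> last ps \<in> E\<inverse> `` C"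
  using assms
proof (induction rule: converse_rtrancl_on_induct)
  case (step x y)
  show ?case
  proof (cases "y \<in> C")
    case True
    with step show ?thesis by (intro exI[of _ "[x]"]) auto
  next
    case False
    with step obtain ps where "ps \<noteq> []" "hd ps = y" "set ps \<inter> C = {}"
      "successively (\<lambda>x y. (x, y) \<in> E) ps" "last ps \<in> E\<inverse> `` C" by auto
    with step show ?thesis
      by (intro exI[of _ "x # ps"]) (auto simp: successively_Cons)
  qed
qed simp

text \<open>A path from \<open>C\<close> to a vertex outside uses an arc leaving \<open>C\<close>; a
  path from the head of that arc back to \<open>C\<close>, cut when it enters \<open>C\<close>, is
  an ear.\<close>

lemma ex_ear:
  assumes "strong_on E V" "C \<subseteq> V" "C \<noteq> {}" "C \<noteq> V"
  shows "\<exists>ps. ear E C ps"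
proof -
  obtain c x where c: "c \<in> C" and x: "x \<in> V" "x \<notin> C"
    using assms by blast
  have "(c, x) \<in> rtrancl_on V E"
    using assms c x by (auto simp: strong_on_def)
  then have "\<exists>d p. d \<in> C \<and> p \<in> V \<and> p \<notin> C \<and> (d, p) \<in> E"
    using c x by (induction rule: converse_rtrancl_on_induct) auto
  then obtain d p where p: "d \<in> C" "p \<in> V" "p \<notin> C" "(d, p) \<in> E" by blast
  then have "(p, c) \<in> rtrancl_on V E"
    using assms c by (auto simp: strong_on_def)
  from walk_into[OF this p(3) c] p show ?thesis
    unfolding ear_def by blast
qed

text \<open>Every vertex of an ear is the tail of an arc, the last one by its arc into
  \<open>C\<close>.\<close>

lemma ear_subset:
  assumes "ear E C ps" "E \<subseteq> V \<times> V"
  shows "set ps \<subseteq> V"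
proof
  fix x assume "x \<in> set ps"
  then have "(x, last ps) \<in> rtrancl_on (set ps) E"
    using assms walk_member_reaches_last by (fastforce simp: ear_def)
  then show "x \<in> V"
    using assms by (cases rule: converse_rtrancl_on_cases) (auto simp: ear_def)
qed

text \<open>The new ear has \<open>length ps - j + 1\<close> vertices, so if \<open>ps\<close> is
  shortest then \<open>j \<le> 1\<close>. The variant below, with two new vertices, gives
  \<open>j \<le> 2\<close>.\<close>

lemma ear_Cons_drop:
  assumes "ear E C ps" "x \<in> E `` C" "x \<notin> C" "j < length ps" "(x, ps ! j) \<in> E"
  shows "ear E C (x # drop j ps)"
proof -
  have "successively (\<lambda>x y. (x, y) \<in> E) (drop j ps)"
    using assms(1) by (metis append_take_drop_id ear_def successively_append_iff)
  with assms show ?thesis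
    by (auto simp: ear_def successively_Cons hd_drop_conv_nth dest: in_set_dropD)
qed

lemma ear_Cons_Cons_drop:
  assumes "ear E C ps" "x \<in> E `` C" "x \<notin> C" "(x, y) \<in> E" "y \<notin> C"
    and "j < length ps" "(y, ps ! j) \<in> E"
  shows "ear E C (x # y # drop j ps)"
proof -
  have "successively (\<lambda>x y. (x, y) \<in> E) (drop j ps)"
    using assms(1) by (metis append_take_drop_id ear_def successively_append_iff)
  with assms show ?thesis
    by (auto simp: ear_def successively_Cons hd_drop_conv_nth dest: in_set_dropD)
qed

section \<open>Stars that avoid an ear\<close>

locale strong_relation =
  fixes V :: "'a set" and E :: "'a rel" and m :: nat
  assumes finite_V: "finite V" and E_subset: "E \<subseteq> V \<times> V" and irrefl: "(x, x) \<notin> E"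
    and strong: "strong_on E V" and m_ge: "3 \<le> m"
    and out_card: "v \<in> V \<Longrightarrow> m + 1 \<le> card (E `` {v})"
    and in_card: "v \<in> V \<Longrightarrow> m + 1 \<le> card (E\<inverse> `` {v})"
begin

lemma finite_subset_V: "S \<subseteq> V \<Longrightarrow> finite S"
  using finite_V finite_subset by blast

lemma finite_Image: "finite (E `` S)" "finite (E\<inverse> `` S)"
  by (rule finite_subset_V; use E_subset in auto)+

text \<open>Of the at least \<open>m + 1\<close> out-neighbours of \<open>v\<close>, none lies in
  \<open>C\<close> and at most two lie in \<open>P\<close>, so \<open>v\<close> is the center of a
  star on the rest.\<close>

lemma has_star_by_out:
  assumes "v \<in> V" "v \<notin> C" "v \<notin> P" "v \<notin> E\<inverse> `` C"
    and "E `` {v} \<inter> P \<subseteq> Q" "finite Q" "card Q \<le> 2"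
  shows "has_star E (m - 1) (V - C - P)"
proof -
  have "E `` {v} - Q \<subseteq> E `` {v} \<inter> (V - C - P)"
    using assms E_subset by auto
  then have "card (E `` {v} - Q) \<le> card (E `` {v} \<inter> (V - C - P))"
    using finite_Image by (intro card_mono) auto
  moreover have "card (E `` {v}) - card Q \<le> card (E `` {v} - Q)"
    using assms by (intro diff_card_le_card_Diff) auto
  ultimately have "m - 1 \<le> card (E `` {v} \<inter> (V - C - P))"
    using out_card[OF assms(1)] assms(7) by linarith
  then show ?thesis
    using assms unfolding has_star_def by blast
qed

lemma has_star_by_in:
  assumes "v \<in> V" "v \<notin> C" "v \<notin> P" "v \<notin> E `` C"
    and "E\<inverse> `` {v} \<inter> P \<subseteq> Q" "finite Q" "card Q \<le> 2"
  shows "has_star E (m - 1) (V - C - P)"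
proof -
  have "E\<inverse> `` {v} - Q \<subseteq> E\<inverse> `` {v} \<inter> (V - C - P)"
    using assms E_subset by auto
  then have "card (E\<inverse> `` {v} - Q) \<le> card (E\<inverse> `` {v} \<inter> (V - C - P))"
    using finite_Image by (intro card_mono) auto
  moreover have "card (E\<inverse> `` {v}) - card Q \<le> card (E\<inverse> `` {v} - Q)"
    using assms by (intro diff_card_le_card_Diff) auto
  ultimately have "m - 1 \<le> card (E\<inverse> `` {v} \<inter> (V - C - P))"
    using in_card[OF assms(1)] assms(7) by linarith
  then show ?thesis
    using assms unfolding has_star_def by blast
qed

lemma short_ear_avoids_star:
  assumes "v \<in> V" "v \<notin> C" "v \<notin> set ps" "v \<notin> E `` C \<or> v \<notin> E\<inverse> `` C" "length ps \<le> 2"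
  shows "has_star E (m - 1) (V - C - set ps)"
proof -
  have "card (set ps) \<le> 2"
    using card_length[of ps] assms(5) by linarith
  then show ?thesis
    using assms has_star_by_out[of v C "set ps" "set ps"] has_star_by_in[of v C "set ps" "set ps"]
    by auto
qed

end

section \<open>Shortest ears with at least three vertices\<close>

locale shortest_ear = strong_relation +
  fixes C :: "'a set" and k :: nat
  assumes k_ge: "3 \<le> k" and k_minimal: "ear E C qs \<Longrightarrow> k \<le> length qs"
    and no_star: "ear E C qs \<Longrightarrow> \<not> has_star E (m - 1) (V - C - set qs)"
begin

lemma not_two_way_adjacent:
  assumes "v \<notin> C" "v \<in> E `` C"
  shows "v \<notin> E\<inverse> `` C"
proof
  assume "v \<in> E\<inverse> `` C"
  then have "ear E C [v]"
    using assms by (auto simp: ear_def)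
  then show False
    using k_minimal k_ge by fastforce
qed

text \<open>Only the length \<open>k\<close> is fixed in the locale: \<open>no_shortest_ear\<close>
  applies these facts to two different ears of length \<open>k\<close>.\<close>

context
  fixes ps
  assumes ps: "ear E C ps" "length ps = k"
begin

lemma arc_from_out_neighbour:
  assumes "v \<in> E `` C" "v \<notin> C" "j < k" "(v, ps ! j) \<in> E"
  shows "j \<le> 1"
  using k_minimal[OF ear_Cons_drop[OF ps(1) assms(1,2) _ assms(4)]] assms(3) ps(2) by simp

lemma arc_from_second_out_neighbour:
  assumes "u \<in> E `` C" "u \<notin> C" "(u, v) \<in> E" "v \<notin> C" "j < k" "(v, ps ! j) \<in> E"
  shows "j \<le> 2"
  using k_minimal[OF ear_Cons_Cons_drop[OF ps(1) assms(1-4) _ assms(6)]] assms(5) ps(2) by simp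

text \<open>Otherwise the part of the ear from \<open>ps ! j\<close> on would be a shorter
  ear.\<close>

lemma nth_in_out_neighbours:
  assumes "j < k" "ps ! j \<in> E `` C"
  shows "j = 0"
proof -
  have "successively (\<lambda>x y. (x, y) \<in> E) (drop j ps)"
    using ps(1) by (metis append_take_drop_id ear_def successively_append_iff)
  then have "ear E C (drop j ps)"
    using ps assms by (auto simp: ear_def hd_drop_conv_nth dest: in_set_dropD)
  then show ?thesis
    using k_minimal[of "drop j ps"] ps(2) assms(1) by simp
qed

text \<open>With \<open>nth_in_out_neighbours\<close>, this makes \<open>ps ! 0\<close> the only
  out-neighbour of \<open>C\<close> outside \<open>C\<close>.\<close>

lemma out_neighbours_subset: "E `` C - C \<subseteq> set ps"
proof (rule ccontr)
  assume "\<not> E `` C - C \<subseteq> set ps"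
  then obtain v where v: "v \<in> E `` C" "v \<notin> C" "v \<notin> set ps" by blast
  have "E `` {v} \<inter> set ps \<subseteq> {ps ! 0, ps ! 1}"
  proof
    fix x assume "x \<in> E `` {v} \<inter> set ps"
    then obtain j where "j < k" "x = ps ! j" "(v, ps ! j) \<in> E"
      using ps(2) by (auto simp: in_set_conv_nth)
    then show "x \<in> {ps ! 0, ps ! 1}"
      using arc_from_out_neighbour[OF v(1,2)] by (auto simp: le_Suc_eq)
  qed
  then have "has_star E (m - 1) (V - C - set ps)"
    using v E_subset not_two_way_adjacent
    by (intro has_star_by_out[of v]) (auto intro: card_insert_le_m1)
  then show False
    using no_star ps(1) by blast
qed

lemma hd_props: "ps ! 0 \<in> E `` C" "ps ! 0 \<notin> C" "ps ! 0 \<in> V" "(ps ! 0, ps ! 1) \<in> E"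
proof -
  obtain p q rs where eq: "ps = p # q # rs"
    using ps(2) k_ge by (metis Suc_le_length_iff numeral_3_eq_3)
  then show "ps ! 0 \<in> E `` C" "ps ! 0 \<notin> C" "ps ! 0 \<in> V" "(ps ! 0, ps ! 1) \<in> E"
    using ps(1) E_subset by (auto simp: ear_def)
qed

text \<open>An arc from \<open>ps ! 0\<close> into \<open>C\<close>, or from \<open>v\<close> into
  \<open>C\<close>, would close an ear of one or two vertices. An arc from \<open>C\<close> to
  \<open>v\<close> would force \<open>v = ps ! 0\<close>, a loop. On the ear, \<open>v\<close> could
  only have index 0 or 1.\<close>

lemma hd_out_neighbour:
  assumes "(ps ! 0, v) \<in> E"
  shows "v \<notin> C" "v \<notin> E `` C" "v \<notin> E\<inverse> `` C" "v \<noteq> ps ! 1 \<Longrightarrow> v \<notin> set ps"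
proof -
  show vC: "v \<notin> C"
    using not_two_way_adjacent hd_props assms by blast
  show "v \<notin> E `` C"
  proof
    assume *: "v \<in> E `` C"
    then obtain j where "j < k" "v = ps ! j"
      using out_neighbours_subset vC ps(2) by (metis DiffI in_set_conv_nth subsetD)
    with * nth_in_out_neighbours[of j] assms irrefl show False by auto
  qed
  show "v \<notin> E\<inverse> `` C"
  proof
    assume "v \<in> E\<inverse> `` C"
    then have "ear E C [ps ! 0, v]"
      using vC hd_props assms by (auto simp: ear_def)
    then show False
      using k_minimal k_ge by fastforce
  qed
  show "v \<notin> set ps" if "v \<noteq> ps ! 1"
  proof
    assume "v \<in> set ps"
    then obtain j where j: "j < k" "v = ps ! j"
      using ps(2) by (metis in_set_conv_nth)
    then have "j \<le> 1"
      using arc_from_out_neighbour hd_props assms by blast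
    then show False
      using j that irrefl assms by (auto simp: le_Suc_eq)
  qed
qed

text \<open>The arc to \<open>ps ! 2\<close> allows \<open>v\<close> to replace
  \<open>ps ! 1\<close>; the arc to \<open>ps ! 1\<close> is the fact later reused for an ear
  changed in this way.\<close>

lemma hd_out_neighbour_arcs:
  assumes "(ps ! 0, v) \<in> E" "v \<noteq> ps ! 1"
  shows "(v, ps ! 1) \<in> E" "(v, ps ! 2) \<in> E"
proof -
  note v = hd_out_neighbour[OF assms(1)]
  have sub: "E `` {v} \<inter> set ps \<subseteq> E `` {v} \<inter> {ps ! 0, ps ! 1, ps ! 2}"
  proof
    fix x assume x: "x \<in> E `` {v} \<inter> set ps"
    then obtain j where j: "j < k" "x = ps ! j" "(v, ps ! j) \<in> E"
      using ps(2) by (auto simp: in_set_conv_nth)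
    then have "j \<le> 2"
      using arc_from_second_out_neighbour hd_props assms v by blast
    then have "j = 0 \<or> j = 1 \<or> j = 2" by linarith
    then show "x \<in> E `` {v} \<inter> {ps ! 0, ps ! 1, ps ! 2}"
      using j x by auto
  qed
  \<comment> \<open>\<open>q\<close> is whichever of \<open>ps ! 1\<close> and \<open>ps ! 2\<close>
    may remain when the arc to the other one is missing.\<close>
  have "False" if Q: "E `` {v} \<inter> {ps ! 0, ps ! 1, ps ! 2} \<subseteq> {ps ! 0, q}" for q
  proof -
    have "has_star E (m - 1) (V - C - set ps)"
    proof (rule has_star_by_out[of v _ _ "{ps ! 0, q}"])
      show "E `` {v} \<inter> set ps \<subseteq> {ps ! 0, q}" using sub Q by blast
    qed (use v assms E_subset in \<open>auto intro: card_insert_le_m1\<close>)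
    then show False
      using no_star ps(1) by blast
  qed
  from this[of "ps ! 1"] this[of "ps ! 2"]
  show "(v, ps ! 1) \<in> E" "(v, ps ! 2) \<in> E" by auto
qed

end

lemma no_shortest_ear:
  assumes ps: "ear E C ps" "length ps = k"
  shows False
proof -
  define L where "L = E `` {ps ! 0}"
  note hd = hd_props[OF ps]
  have L_card: "m + 1 \<le> card L"
    using out_card hd by (simp add: L_def)
  have "\<not> card L \<le> 1"
    using L_card m_ge by linarith
  then obtain v where v: "v \<in> L" "v \<noteq> ps ! 1"
    using card_mono[of "{ps ! 1}" L] by auto
  have "(v, w) \<in> E" if w: "w \<in> L" "w \<noteq> v" "w \<noteq> ps ! 1" for w
  proof -
    \<comment> \<open>\<open>w\<close> can replace the second vertex of the ear, so \<open>v\<close> must also send an arc to \<open>w\<close>.\<close>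
    let ?qs = "ps ! 0 # w # drop 2 ps"
    have "(w, ps ! 2) \<in> E" "w \<notin> C"
      using hd_out_neighbour_arcs[OF ps] hd_out_neighbour[OF ps] w by (auto simp: L_def)
    then have "ear E C ?qs"
      using ps hd w k_ge by (intro ear_Cons_Cons_drop) (auto simp: L_def)
    moreover have "length ?qs = k"
      using ps k_ge by simp
    ultimately show ?thesis
      using hd_out_neighbour_arcs(1)[of ?qs v] v w by (auto simp: L_def)
  qed
  \<comment> \<open>Only \<open>v\<close> itself and \<open>ps ! 1\<close>, which lies on the ear,
    are lost from \<open>L\<close>, so at least \<open>m - 1\<close> leaves remain.\<close>
  then have sub: "L - {v, ps ! 1} \<subseteq> E `` {v} \<inter> (V - C - set ps)"
    using hd_out_neighbour[OF ps] E_subset by (auto simp: L_def)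
  have "card L - card {v, ps ! 1} \<le> card (L - {v, ps ! 1})"
    by (intro diff_card_le_card_Diff) auto
  also have "\<dots> \<le> card (E `` {v} \<inter> (V - C - set ps))"
    using finite_Image by (intro card_mono sub) auto
  finally have "m - 1 \<le> card (E `` {v} \<inter> (V - C - set ps))"
    using L_card v by simp
  moreover have "v \<in> V - C - set ps"
    using hd_out_neighbour[OF ps] v E_subset by (auto simp: L_def)
  ultimately show False
    using no_star[OF ps(1)] unfolding has_star_def by blast
qed

end

section \<open>Enlarging a strong set, and a largest one\<close>

context strong_relation
begin

text \<open>The improvement step: while the star \<open>T\<close> misses some vertex
  \<open>r\<close> outside \<open>C\<close>, an ear can be absorbed with a star still left
  outside.\<close>

lemma ex_ear_avoiding_star:
  assumes C: "strong_on E C" "C \<subseteq> V"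
    and T: "has_star E (m - 1) T" "T \<subset> V - C" "3 \<le> card T"
  shows "\<exists>ps. ear E C ps \<and> has_star E (m - 1) (V - C - set ps)"
proof (rule ccontr)
  assume "\<not> ?thesis"
  then have no_star: "\<And>qs. ear E C qs \<Longrightarrow> \<not> has_star E (m - 1) (V - C - set qs)" by blast
  obtain r where r: "r \<in> V - C" "r \<notin> T"
    using T by blast
  have "\<exists>ps. ear E C ps"
    using C r strong by (intro ex_ear) (auto simp: strong_on_def)
  then obtain ps where ps: "ear E C ps" "\<And>qs. ear E C qs \<Longrightarrow> length ps \<le> length qs"
    using ex_has_least_nat[of "ear E C" _ length] by blast
  have short: "v \<in> E `` C \<and> v \<in> E\<inverse> `` C"
    if "v \<in> V - C" "v \<notin> set ps" "length ps \<le> 2" for v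
    using short_ear_avoids_star no_star[OF ps(1)] that by blast
  \<comment> \<open>The one-vertex ear at \<open>r\<close> would leave all of \<open>T\<close>
    outside.\<close>
  have "\<not> (r \<in> E `` C \<and> r \<in> E\<inverse> `` C)"
  proof
    assume "r \<in> E `` C \<and> r \<in> E\<inverse> `` C"
    then have "ear E C [r]"
      using r by (auto simp: ear_def)
    moreover have "has_star E (m - 1) (V - C - set [r])"
      using T r finite_V by (intro has_star_mono[OF T(1)]) auto
    ultimately show False
      using no_star by blast
  qed
  then have r_ps: "r \<in> set ps" if "length ps \<le> 2"
    using short[of r] r that by blast
  have "3 \<le> length ps"
  proof (rule ccontr)
    assume "\<not> 3 \<le> length ps"
    then have le: "length ps \<le> 2" by simp
    \<comment> \<open>The ear is too short to cover \<open>T\<close>, so some \<open>t\<close> in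
      \<open>T\<close> is an ear by itself; the shortest ear then has one vertex, which must be
      \<open>r\<close>.\<close>
    have "card (set ps) < card T"
      using card_length[of ps] le T(3) by linarith
    then obtain t where t: "t \<in> T" "t \<notin> set ps"
      using card_mono[of "set ps" T] by auto
    then have "t \<in> E `` C \<and> t \<in> E\<inverse> `` C"
      using short[of t] T le by blast
    then have "ear E C [t]"
      using t T by (auto simp: ear_def)
    then have "length ps \<le> 1"
      using ps(2) by fastforce
    moreover have "ps \<noteq> []"
      using ps(1) by (simp add: ear_def)
    ultimately have "ps = [r]"
      using r_ps[OF le] by (cases ps) auto
    then show False
      using ps(1) \<open>\<not> (r \<in> E `` C \<and> r \<in> E\<inverse> `` C)\<close> by (auto simp: ear_def)
  qed
  then interpret shortest_ear V E m C "length ps"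
    using ps(2) no_star by unfold_locales auto
  show False
    using no_shortest_ear ps(1) by blast
qed

theorem ex_star_strong_complement:
  "\<exists>c L. c \<in> V \<and> c \<notin> L \<and> card L = m - 1 \<and> (L \<subseteq> E `` {c} \<or> L \<subseteq> E\<inverse> `` {c})
    \<and> strong_on E (V - insert c L)"
proof -
  let ?P = "\<lambda>C. C \<subseteq> V \<and> strong_on E C \<and> has_star E (m - 1) (V - C)"
  obtain v where v: "v \<in> V"
    using strong by (auto simp: strong_on_def)
  have "?P {v}"
  proof (intro conjI)
    show "strong_on E {v}" by (auto simp: strong_on_def)
    have "E `` {v} \<noteq> {}"
      using out_card[OF v] by (intro notI) simp
    then obtain w where w: "(v, w) \<in> E" by blast
    have "E `` {w} \<inter> {v} \<subseteq> {v}" by blast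
    \<comment> \<open>\<open>w\<close> may have an arc to \<open>v\<close>, so \<open>v\<close> is
      put into \<open>P\<close>, with the empty set as \<open>C\<close>; this costs at most one
      out-neighbour.\<close>
    then have "has_star E (m - 1) (V - {} - {v})"
      using w irrefl E_subset by (intro has_star_by_out[of w _ _ "{v}"]) auto
    then show "has_star E (m - 1) (V - {v})" by simp
  qed (use v in simp)
  moreover have "\<forall>C. ?P C \<longrightarrow> card C < Suc (card V)"
    using card_mono[OF finite_V] by (simp add: less_Suc_eq_le)
  ultimately obtain C where C: "?P C" and max: "\<And>C'. ?P C' \<Longrightarrow> card C' \<le> card C"
    using ex_has_greatest_nat[of ?P "{v}" card "Suc (card V)"] by blast
  from C obtain c where c: "c \<in> V - C"
    and star: "m - 1 \<le> card (E `` {c} \<inter> (V - C)) \<or> m - 1 \<le> card (E\<inverse> `` {c} \<inter> (V - C))"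
    unfolding has_star_def by blast
  \<comment> \<open>Trim the neighbours to exactly \<open>m - 1\<close> leaves.\<close>
  have "\<exists>L. L \<subseteq> V - C \<and> card L = m - 1 \<and> (L \<subseteq> E `` {c} \<or> L \<subseteq> E\<inverse> `` {c})"
    using star
  proof
    assume "m - 1 \<le> card (E `` {c} \<inter> (V - C))"
    then show ?thesis by (rule obtain_subset_with_card_n) auto
  next
    assume "m - 1 \<le> card (E\<inverse> `` {c} \<inter> (V - C))"
    then show ?thesis by (rule obtain_subset_with_card_n) auto
  qed
  then obtain L where L: "L \<subseteq> V - C" "card L = m - 1" "L \<subseteq> E `` {c} \<or> L \<subseteq> E\<inverse> `` {c}"
    by blast
  have cL: "c \<notin> L"
    using L(3) irrefl by auto
  have L_fin: "finite L"
    using L(1) finite_subset_V by blast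
  let ?T = "insert c L"
  have "?T = V - C"
  proof (rule ccontr)
    assume "?T \<noteq> V - C"
    then have T: "?T \<subset> V - C"
      using c L by blast
    have "card L \<le> card (R \<inter> ?T)" if "L \<subseteq> R" for R
      using that L_fin by (intro card_mono) auto
    then have "has_star E (m - 1) ?T"
      using L(2,3) unfolding has_star_def by (intro bexI[of _ c]) auto
    moreover have "3 \<le> card ?T"
      using L(2) cL L_fin m_ge by simp
    ultimately obtain ps where ps: "ear E C ps" "has_star E (m - 1) (V - C - set ps)"
      using ex_ear_avoiding_star[of C ?T] C T by auto
    have "V - C - set ps = V - (C \<union> set ps)" by blast
    then have "?P (C \<union> set ps)"
      using ps(2) C strong_on_union_ear[OF _ ps(1)] ear_subset[OF ps(1) E_subset] by simp
    then have "card (C \<union> set ps) \<le> card C" by (rule max)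
    moreover have "C \<subset> C \<union> set ps"
      using ps(1) unfolding ear_def by (cases ps) auto
    moreover have "finite (C \<union> set ps)"
      using C finite_subset_V by blast
    ultimately show False
      by (meson leD psubset_card_mono)
  qed
  then have "V - ?T = C"
    using C by blast
  then show ?thesis
    using c cL L C by auto
qed

end

section \<open>Translation between relations and digraphs\<close>

lemma strongly_connected_induce_iff:
  "strongly_connected (D \<restriction> S) \<longleftrightarrow> strong_on (arcs_ends D) S"
proof -
  \<comment> \<open>\<open>rtrancl_on S\<close> already confines paths to \<open>S\<close>, so
    discarding arcs with an end outside \<open>S\<close> changes no reachability.\<close>
  have "rtrancl_on S (arcs_ends (D \<restriction> S)) = rtrancl_on S (arcs_ends D)" (is "?A = ?B")
  proof (intro equalityI subrelI)
    show "(u, v) \<in> ?B" if "(u, v) \<in> ?A" for u v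
      using that by (rule rtrancl_on_mono[rotated 2]) (auto simp: arcs_ends_conv)
    show "(u, v) \<in> ?A" if "(u, v) \<in> ?B" for u v
      using that
    proof (induction rule: rtrancl_on_induct)
      case (step y z)
      then have "(y, z) \<in> arcs_ends (D \<restriction> S)"
        by (auto simp: arcs_ends_conv)
      with step show ?case
        by (auto intro: rtrancl_on_into_rtrancl_on)
    qed simp
  qed
  then show ?thesis
    by (simp add: strongly_connected_def strong_on_def reachable_def)
qed

lemma (in digraph) out_degree_eq_card_Image: "out_degree G v = card (arcs_ends G `` {v})"
proof -
  have "inj_on (head G) (out_arcs G v)"
    using no_multi_arcs by (auto simp: inj_on_def out_arcs_def arc_to_ends_def)
  moreover have "head G ` out_arcs G v = arcs_ends G `` {v}"
    by (force simp: out_arcs_def arcs_ends_conv)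
  ultimately show ?thesis
    unfolding out_degree_def by (metis card_image)
qed

lemma (in digraph) in_degree_eq_card_Image: "in_degree G v = card ((arcs_ends G)\<inverse> `` {v})"
proof -
  have "inj_on (tail G) (in_arcs G v)"
    using no_multi_arcs by (auto simp: inj_on_def in_arcs_def arc_to_ends_def)
  moreover have "tail G ` in_arcs G v = (arcs_ends G)\<inverse> `` {v}"
    by (force simp: in_arcs_def arcs_ends_conv)
  ultimately show ?thesis
    unfolding in_degree_def by (metis card_image)
qed

lemma ex_star_labelling:
  assumes "finite L" "c \<notin> L"
  shows "\<exists>f. bij_betw f (insert c L) {0..<Suc (card L)} \<and> f c = 0 \<and> f ` L = {1..<Suc (card L)}"
proof -
  have "card L = card {1..<Suc (card L)}" by simp
  then obtain g where g: "bij_betw g L {1..<Suc (card L)}"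
    using assms(1) finite_same_card_bij by blast
  let ?f = "g(c := 0)"
  have "?f ` L = {1..<Suc (card L)}"
    using g assms(2) by (auto simp: bij_betw_def image_iff)
  moreover have "bij_betw ?f L {1..<Suc (card L)}"
    using g assms(2) by (metis bij_betw_cong fun_upd_other)
  then have "bij_betw ?f (insert c L) (insert 0 {1..<Suc (card L)})"
    using assms(2) notIn_Un_bij_betw[of c L ?f "{1..<Suc (card L)}"] by simp
  moreover have "insert 0 {1..<Suc (card L)} = {0..<Suc (card L)}" by auto
  ultimately show ?thesis by (intro exI[of _ ?f]) simp
qed

text \<open>Take all arcs from \<open>c\<close> into \<open>L\<close>. As arcs of
  \<open>out_star\<close> are pairs, the isomorphism sends an arc to the labels of its two
  ends.\<close>

lemma (in digraph) ex_out_star_subgraph: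
  assumes "c \<in> verts G" "c \<notin> L" "finite L" "L \<subseteq> arcs_ends G `` {c}"
  shows "\<exists>T. subgraph T G \<and> verts T = insert c L
    \<and> digraph_iso T (with_proj (out_star (Suc (card L))))"
proof -
  obtain f where f: "bij_betw f (insert c L) {0..<Suc (card L)}" "f c = 0"
    "f ` L = {1..<Suc (card L)}"
    using ex_star_labelling assms by metis
  define A where "A = {e \<in> arcs G. tail G e = c \<and> head G e \<in> L}"
  let ?T = "\<lparr>verts = insert c L, arcs = A, tail = tail G, head = head G\<rparr>"
  have L: "L \<subseteq> verts G"
    using assms by (auto simp: arcs_ends_conv)
  have wf: "wf_digraph ?T"
    by unfold_locales (auto simp: A_def)
  have "subgraph ?T G"
    using L assms wf wf_digraph by (auto simp: subgraph_def compatible_def A_def)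
  have head_A: "head G ` A = L"
    using assms(4) by (force simp: A_def arcs_ends_conv)
  let ?h = "\<lparr>iso_verts = f, iso_arcs = \<lambda>e. (f (tail G e), f (head G e)), iso_head = snd, iso_tail = fst\<rparr>"
  have inj: "inj_on f (insert c L)"
    using f by (simp add: bij_betw_def)
  \<comment> \<open>All arcs of \<open>A\<close> have tail \<open>c\<close>; without parallel arcs
    the head determines the arc.\<close>
  have "e = e'" if "e \<in> A" "e' \<in> A" "f (head G e) = f (head G e')" for e e'
  proof -
    have "head G e = head G e'"
      using that inj by (auto simp: A_def dest: inj_onD)
    then show ?thesis
      using that by (intro no_multi_arcs) (auto simp: A_def arc_to_ends_def)
  qed
  then have "pre_digraph.digraph_isomorphism ?T ?h"
    using inj wf by (auto simp: pre_digraph.digraph_isomorphism_def intro!: inj_onI)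
  moreover have "with_proj (out_star (Suc (card L))) = app_iso ?h ?T"
  proof -
    have "(\<lambda>e. (f (tail G e), f (head G e))) ` A = (\<lambda>x. (0, f x)) ` head G ` A"
      using f(2) by (force simp: A_def image_image)
    also have "\<dots> = Pair 0 ` f ` L"
      by (simp add: head_A image_image)
    also have "\<dots> = {(0, i) | i. i \<in> {1..<Suc (card L)}}"
      unfolding f(3) by auto
    finally show ?thesis
      using f(1) by (simp add: with_proj_def app_iso_def out_star_def bij_betw_def)
  qed
  ultimately show ?thesis
    using \<open>subgraph ?T G\<close> unfolding digraph_iso_def by (intro exI[of _ ?T]) auto
qed

lemma (in digraph) ex_in_star_subgraph:
  assumes "c \<in> verts G" "c \<notin> L" "finite L" "L \<subseteq> (arcs_ends G)\<inverse> `` {c}"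
  shows "\<exists>T. subgraph T G \<and> verts T = insert c L
    \<and> digraph_iso T (with_proj (in_star (Suc (card L))))"
proof -
  obtain f where f: "bij_betw f (insert c L) {0..<Suc (card L)}" "f c = 0"
    "f ` L = {1..<Suc (card L)}"
    using ex_star_labelling assms by metis
  define A where "A = {e \<in> arcs G. head G e = c \<and> tail G e \<in> L}"
  let ?T = "\<lparr>verts = insert c L, arcs = A, tail = tail G, head = head G\<rparr>"
  have L: "L \<subseteq> verts G"
    using assms by (auto simp: arcs_ends_conv)
  have wf: "wf_digraph ?T"
    by unfold_locales (auto simp: A_def)
  have "subgraph ?T G"
    using L assms wf wf_digraph by (auto simp: subgraph_def compatible_def A_def)
  have tail_A: "tail G ` A = L"
    using assms(4) by (force simp: A_def arcs_ends_conv)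
  let ?h = "\<lparr>iso_verts = f, iso_arcs = \<lambda>e. (f (tail G e), f (head G e)), iso_head = snd, iso_tail = fst\<rparr>"
  have inj: "inj_on f (insert c L)"
    using f by (simp add: bij_betw_def)
  have "e = e'" if "e \<in> A" "e' \<in> A" "f (tail G e) = f (tail G e')" for e e'
  proof -
    have "tail G e = tail G e'"
      using that inj by (auto simp: A_def dest: inj_onD)
    then show ?thesis
      using that by (intro no_multi_arcs) (auto simp: A_def arc_to_ends_def)
  qed
  then have "pre_digraph.digraph_isomorphism ?T ?h"
    using inj wf by (auto simp: pre_digraph.digraph_isomorphism_def intro!: inj_onI)
  moreover have "with_proj (in_star (Suc (card L))) = app_iso ?h ?T"
  proof -
    have "(\<lambda>e. (f (tail G e), f (head G e))) ` A = (\<lambda>x. (f x, 0)) ` tail G ` A"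
      using f(2) by (force simp: A_def image_image)
    also have "\<dots> = (\<lambda>i. (i, 0)) ` f ` L"
      by (simp add: tail_A image_image)
    also have "\<dots> = {(i, 0) | i. i \<in> {1..<Suc (card L)}}"
      unfolding f(3) by auto
    finally show ?thesis
      using f(1) by (simp add: with_proj_def app_iso_def in_star_def bij_betw_def)
  qed
  ultimately show ?thesis
    using \<open>subgraph ?T G\<close> unfolding digraph_iso_def by (intro exI[of _ ?T]) auto
qed

theorem theorem4p2:
  fixes D :: "('a, 'b) pre_digraph" and m :: nat
  assumes "m \<ge> 3"
    and "digraph D"
    and "strongly_connected D"
    and "min_semi_degree D \<ge> m + 1"
  shows "\<exists>T. subgraph T D
    \<and> (digraph_iso T (with_proj (out_star m)) \<or> digraph_iso T (with_proj (in_star m)))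
    \<and> strongly_connected (D \<restriction> (verts D - verts T))"
proof -
  interpret digraph D by fact
  have out: "m + 1 \<le> out_degree D v" if "v \<in> verts D" for v
  proof -
    have "min_out_degree D \<le> out_degree D v"
      using that by (simp add: min_out_degree_def)
    then show ?thesis
      using assms(4) by (simp add: min_semi_degree_def)
  qed
  have inn: "m + 1 \<le> in_degree D v" if "v \<in> verts D" for v
  proof -
    have "min_in_degree D \<le> in_degree D v"
      using that by (simp add: min_in_degree_def)
    then show ?thesis
      using assms(4) by (simp add: min_semi_degree_def)
  qed
  interpret strong_relation "verts D" "arcs_ends D" m
  proof
    show "strong_on (arcs_ends D) (verts D)"
      using assms(3) by (simp add: strongly_connected_def strong_on_def reachable_def)
  qed (use assms(1) out inn no_loops in
      \<open>auto simp: out_degree_eq_card_Image in_degree_eq_card_Image arcs_ends_conv\<close>)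
  obtain c L where cL: "c \<in> verts D" "c \<notin> L" "card L = m - 1"
    and star: "L \<subseteq> arcs_ends D `` {c} \<or> L \<subseteq> (arcs_ends D)\<inverse> `` {c}"
    and strong: "strong_on (arcs_ends D) (verts D - insert c L)"
    using ex_star_strong_complement by blast
  \<comment> \<open>\<open>card L\<close> is positive, whereas an infinite set has
    \<open>card\<close> 0.\<close>
  have "finite L" and m: "Suc (card L) = m"
    using cL(3) assms(1) by (auto intro: card_ge_0_finite)
  then have "\<exists>T. subgraph T D \<and> verts T = insert c L
    \<and> (digraph_iso T (with_proj (out_star m)) \<or> digraph_iso T (with_proj (in_star m)))"
    using star ex_out_star_subgraph[OF cL(1,2)] ex_in_star_subgraph[OF cL(1,2)] by metis
  then show ?thesis
    using strong by (metis strongly_connected_induce_iff)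
qed

end
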